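(* Let $d\ge1$. For any $\boldsymbol{p}\in(0,1)^d$, there exists $\boldsymbol{I}\in\mathcal{B}_d^{\Sigma}(\boldsymbol{p})$ whose pmf $f_{\boldsymbol{I}}$ maximizes the entropy $H$ in the class $\mathcal{B}_d^{\Sigma}(\boldsymbol{p})$, that follows a conditional Bernoulli distribution, and that satisfies the strongly Rayleigh property.
   Context: $\mathcal{B}_d(\boldsymbol{p})$ is the class of probability mass functions (pmfs) on $\{0,1\}^d$ whose $j$-th one-dimensional marginal is Bernoulli with mean $p_j$, $j=1,\dots,d$; one writes $\boldsymbol{I}\in\mathcal{B}_d(\boldsymbol{p})$ for a random vector with pmf in this class. Two real random variables $X,Y$ on a probability space $(\Omega,\mathcal{F},\mathbb{P})$ are countermonotonic if $(X(\omega)-X(\omega'))(Y(\omega)-Y(\omega'))\le 0$ for $(\mathbb{P}\times\mathbb{P})$-almost every $(\omega,\omega')\in\Omega^2$. A Bernoulli random vector $\boldsymbol{I}=(I_1,\dots,I_d)$ (or its pmf) is $\Sigma$-countermonotonic if for every $\Lambda\subseteq\{1,\dots,d\}$ the random variables $\sum_{j\in\Lambda}I_j$ and $\sum_{j\notin\Lambda}I_j$ are countermonotonic (with $\sum_{j\in\varnothing}I_j=0$). $\mathcal{B}_d^{\Sigma}(\boldsymbol{p})$ is the set of $\Sigma$-countermonotonic elements of $\mathcal{B}_d(\boldsymbol{p})$. Entropy: $H(f)=-\sum_{\boldsymbol{i}\in\{0,1\}^d}f(\boldsymbol{i})\ln f(\boldsymbol{i})$, with $0\ln 0=0$. Conditional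 Bernoulli distribution: let $\boldsymbol{K}=(K_1,\dots,K_d)$ be a vector of independent Bernoulli random variables with means $\boldsymbol{\pi}=(\pi_1,\dots,\pi_d)\in(0,1)^d$. A pmf on $\{0,1\}^d$ is a conditional Bernoulli distribution if, for some such $\boldsymbol{\pi}$, it is either of the form $f^{(m)}_{\boldsymbol{\pi}}(\boldsymbol{i})=\mathbb{P}(\boldsymbol{K}=\boldsymbol{i}\mid K_1+\dots+K_d=m)$ for some $m\in\{0,\dots,d\}$, or of the form $f^{(m+)}_{\boldsymbol{\pi}}(\boldsymbol{i})=\mathbb{P}(\boldsymbol{K}=\boldsymbol{i}\mid m\le K_1+\dots+K_d\le m+1)$ for some $m\in\{0,\dots,d-1\}$. Strongly Rayleigh: the probability generating function of $\boldsymbol{I}$ is $\mathcal{P}_{\boldsymbol{I}}(z_1,\dots,z_d)=E[\prod_{j=1}^d z_j^{I_j}]$, a polynomial with real coefficients. $\boldsymbol{I}$ (or its pmf) satisfies the strongly Rayleigh property if $\mathcal{P}_{\boldsymbol{I}}$ is real stable, i.e. $\mathcal{P}_{\boldsymbol{I}}(z_1,\dots,z_d)\ne0$ whenever all $z_j\in\mathbb{C}$ have strictly positive imaginary part. *)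

theory Defs
  imports "HOL-Probability.Probability"
begin

text \<open>
  The index set \<open>{1, \<dots>, d}\<close> is an arbitrary finite type \<open>'n\<close> (so \<open>d = CARD('n) \<ge> 1\<close>),
  and \<open>{0,1}\<^sup>d\<close> is the type \<open>'n \<Rightarrow> bool\<close>, with \<open>of_bool (i j)\<close> for the \<open>j\<close>-th coordinate as
  a number. A Bernoulli random vector enters only through its pmf \<open>f\<close>; it is represented by
  the coordinate maps on the probability space \<open>measure_pmf f\<close>.
\<close>

definition bernoulli_class :: "('n::finite \<Rightarrow> real) \<Rightarrow> ('n \<Rightarrow> bool) pmf set" where
  "bernoulli_class p = {f. \<forall>j. map_pmf (\<lambda>i. i j) f = bernoulli_pmf (p j)}"

definition countermonotonic :: "'a measure \<Rightarrow> ('a \<Rightarrow> real) \<Rightarrow> ('a \<Rightarrow> real) \<Rightarrow> bool" where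
  "countermonotonic M X Y \<longleftrightarrow>
     (AE (\<omega>, \<omega>') in M \<Otimes>\<^sub>M M. (X \<omega> - X \<omega>') * (Y \<omega> - Y \<omega>') \<le> 0)"

definition sigma_countermonotonic :: "('n::finite \<Rightarrow> bool) pmf \<Rightarrow> bool" where
  "sigma_countermonotonic f \<longleftrightarrow>
     (\<forall>\<Lambda>. countermonotonic (measure_pmf f)
            (\<lambda>i. \<Sum>j\<in>\<Lambda>. of_bool (i j)) (\<lambda>i. \<Sum>j\<in>-\<Lambda>. of_bool (i j)))"

definition sigma_class :: "('n::finite \<Rightarrow> real) \<Rightarrow> ('n \<Rightarrow> bool) pmf set" where
  "sigma_class p = {f \<in> bernoulli_class p. sigma_countermonotonic f}"

text \<open>The convention \<open>0 ln 0 = 0\<close> holds automatically.\<close>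

definition pmf_entropy :: "('n::finite \<Rightarrow> bool) pmf \<Rightarrow> real" where
  "pmf_entropy f = - (\<Sum>i\<in>UNIV. pmf f i * ln (pmf f i))"

definition indep_bernoulli :: "('n::finite \<Rightarrow> real) \<Rightarrow> ('n \<Rightarrow> bool) pmf" where
  "indep_bernoulli \<pi> = Pi_pmf UNIV False (\<lambda>j. bernoulli_pmf (\<pi> j))"

definition num_ones :: "('n::finite \<Rightarrow> bool) \<Rightarrow> nat" where
  "num_ones i = (\<Sum>j\<in>UNIV. of_bool (i j))"

text \<open>
  \<open>cond_pmf\<close> is meaningful only for events of positive probability. This is the case below:
  all \<open>\<pi> j\<close> lie strictly between 0 and 1, so every vector in \<open>{0,1}\<^sup>d\<close> has positive
  probability, and the bounds on \<open>m\<close> make the conditioning events nonempty.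
\<close>

definition conditional_bernoulli :: "('n::finite \<Rightarrow> bool) pmf \<Rightarrow> bool" where
  "conditional_bernoulli f \<longleftrightarrow>
     (\<exists>\<pi> :: 'n \<Rightarrow> real. (\<forall>j. 0 < \<pi> j \<and> \<pi> j < 1) \<and>
        ((\<exists>m \<in> {0..CARD('n)}. f = cond_pmf (indep_bernoulli \<pi>) {k. num_ones k = m}) \<or>
         (\<exists>m \<in> {0..CARD('n) - 1}.
            f = cond_pmf (indep_bernoulli \<pi>) {k. m \<le> num_ones k \<and> num_ones k \<le> m + 1})))"

definition prob_gen_fun :: "('n::finite \<Rightarrow> bool) pmf \<Rightarrow> ('n \<Rightarrow> complex) \<Rightarrow> complex" where
  "prob_gen_fun f z =
     measure_pmf.expectation f (\<lambda>i. \<Prod>j\<in>UNIV. z j ^ (of_bool (i j) :: nat))"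

text \<open>
  Real stability of a polynomial is this non-vanishing property together with real
  coefficients; the coefficients of \<open>prob_gen_fun f\<close> are the real numbers \<open>pmf f i\<close>.
\<close>

definition stable :: "(('n::finite \<Rightarrow> complex) \<Rightarrow> complex) \<Rightarrow> bool" where
  "stable P \<longleftrightarrow> (\<forall>z. (\<forall>j. Im (z j) > 0) \<longrightarrow> P z \<noteq> 0)"

definition strongly_rayleigh :: "('n::finite \<Rightarrow> bool) pmf \<Rightarrow> bool" where
  "strongly_rayleigh f \<longleftrightarrow> stable (prob_gen_fun f)"

end

theory Submission
  imports Defs
begin

text \<open>
  Let \<open>s\<close> be the sum of the \<open>p j\<close>. A Bernoulli vector is \<open>\<Sigma>\<close>-countermonotonic iff the totals
  of any two points of its support differ by at most 1. As the mean total is \<open>s\<close>, this confines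
  the total to \<open>s\<close> rounded down or up, and the class of the theorem consists exactly of the
  pmfs with marginals \<open>p\<close> supported on these central slices of the cube (\<open>sigma_class_eq\<close>).
  Entropy maximization over it is then a problem with linear constraints, solved by
  a log-linear density.

  Such a density with marginals \<open>p\<close> exists because \<open>p\<close> lies in the relative interior of the
  convex hull of the central slices (\<open>central_slices_relative_interior\<close>): the partition function
  is then coercive modulo the directions in which it is constant, and the vanishing of its
  gradient at a minimum is the marginal condition (\<open>exponential_tilt_exists\<close>). A log-linear
  density on these slices has product form there, which is exactly what
  conditioning independent Bernoulli variables on the total produces. Gibbs' inequality shows
  that it maximizes the entropy (\<open>entropy_le_of_product_form\<close>).

  The generating function of a conditional Bernoulli distribution is, after rescaling the
  variables, an elementary symmetric polynomial or the sum of two consecutive ones. Ratios of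
  consecutive elementary symmetric polynomials map tuples from the upper half-plane into the upper
  half-plane (\<open>Im_elem_sym_ratio_pos\<close>), so neither expression vanishes there. Hence every conditional
  Bernoulli distribution is strongly Rayleigh.
\<close>

section \<open>Exponential tilting\<close>

text \<open>
  The hypothesis \<open>rel\<close> says that no linear functional separates the points \<open>W i\<close> properly from
  0, that is, 0 lies in the relative interior of their convex hull; the conclusion is that 0 is
  a positive combination of these points with log-linear weights. The sum is the
  gradient of the partition function \<open>F \<theta> = (\<Sum>i\<in>I. exp (\<theta> \<bullet> W i))\<close>, so a minimum of
  \<open>F\<close> suffices. On the span of the points \<open>rel\<close> makes \<open>F\<close> grow at least linearly in the
  norm, so a minimum over the span exists by compactness. The gradient lies in the span itself,
  and its vanishing along the span makes it orthogonal to itself.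
\<close>
lemma exponential_tilt_exists:
  fixes W :: "'i \<Rightarrow> 'a::euclidean_space"
  assumes fin: "finite I"
    and rel: "\<And>\<theta>. (\<And>i. i \<in> I \<Longrightarrow> \<theta> \<bullet> W i \<le> 0) \<Longrightarrow> (\<And>i. i \<in> I \<Longrightarrow> \<theta> \<bullet> W i = 0)"
  shows "\<exists>\<theta>. (\<Sum>i\<in>I. exp (\<theta> \<bullet> W i) *\<^sub>R W i) = 0"
proof -
  define U where "U = span (W ` I)"
  define F where "F = (\<lambda>\<theta>. \<Sum>i\<in>I. exp (\<theta> \<bullet> W i))"
  \<comment> \<open>\<open>G\<close> is a positively homogeneous minorant of \<open>F\<close>, so its minimum over the unit sphere of
    the span gives the linear growth rate \<open>\<delta>\<close>.\<close>
  define G where "G = (\<lambda>\<theta>. \<Sum>i\<in>I. max 0 (\<theta> \<bullet> W i))"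
  have closedU: "closed U"
    by (simp add: U_def closed_subspace)
  have F_ge_G: "G \<theta> \<le> F \<theta>" for \<theta>
    unfolding F_def G_def
  proof (rule sum_mono)
    fix i
    show "max 0 (\<theta> \<bullet> W i) \<le> exp (\<theta> \<bullet> W i)"
      using exp_ge_add_one_self[of "\<theta> \<bullet> W i"] by (intro max.boundedI) (simp, linarith)
  qed
  have G_pos: "G \<theta> > 0" if "\<theta> \<in> U" "\<theta> \<noteq> 0" for \<theta>
  proof (rule ccontr)
    assume "\<not> G \<theta> > 0"
    moreover have "G \<theta> \<ge> 0" by (simp add: G_def sum_nonneg)
    ultimately have "G \<theta> = 0" by simp
    then have "\<forall>i\<in>I. max 0 (\<theta> \<bullet> W i) = 0"
      unfolding G_def using fin by (subst (asm) sum_nonneg_eq_0_iff) auto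
    then have "\<theta> \<bullet> W i \<le> 0" if "i \<in> I" for i
      using that by (metis max.cobounded2)
    then have "\<theta> \<bullet> W i = 0" if "i \<in> I" for i
      using rel that by blast
    then have "orthogonal \<theta> y" if "y \<in> W ` I" for y
      using that by (auto simp: orthogonal_def)
    then have "orthogonal \<theta> \<theta>"
      using orthogonal_to_span[of \<theta> "W ` I" \<theta>] that(1) by (simp add: U_def)
    then show False using that(2) by (simp add: orthogonal_def)
  qed
  obtain \<delta> where \<delta>: "\<delta> > 0" "\<And>\<theta>. \<theta> \<in> U \<Longrightarrow> \<delta> * norm \<theta> \<le> G \<theta>"
  proof (cases "U \<inter> sphere 0 1 = {}")
    case True
    have "\<theta> = 0" if "\<theta> \<in> U" for \<theta>
    proof (rule ccontr)
      assume "\<theta> \<noteq> 0"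
      then have "(1 / norm \<theta>) *\<^sub>R \<theta> \<in> U \<inter> sphere 0 1"
        using that by (auto simp: U_def span_mul)
      with True show False by blast
    qed
    moreover have "G \<theta> \<ge> 0" for \<theta>
      by (simp add: G_def sum_nonneg)
    ultimately have "\<theta> \<in> U \<Longrightarrow> 1 * norm \<theta> \<le> G \<theta>" for \<theta>
      by (metis mult_1 norm_zero)
    then show thesis using that[of 1] by simp
  next
    case False
    have "compact (U \<inter> sphere 0 1)"
      using closedU by (simp add: closed_Int_compact)
    moreover have "continuous_on (U \<inter> sphere 0 1) G"
      unfolding G_def by (intro continuous_intros)
    ultimately obtain \<theta>0 where \<theta>0: "\<theta>0 \<in> U \<inter> sphere 0 1"
        "\<And>\<theta>. \<theta> \<in> U \<inter> sphere 0 1 \<Longrightarrow> G \<theta>0 \<le> G \<theta>"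
      using continuous_attains_inf[of "U \<inter> sphere 0 1" G] False by blast
    have "G \<theta>0 > 0" using \<theta>0(1) by (intro G_pos) auto
    moreover have "G \<theta>0 * norm \<theta> \<le> G \<theta>" if "\<theta> \<in> U" for \<theta>
    proof (cases "\<theta> = 0")
      case True
      then show ?thesis by (simp add: G_def)
    next
      case False
      let ?u = "(1 / norm \<theta>) *\<^sub>R \<theta>"
      have "?u \<in> U \<inter> sphere 0 1"
        using that False by (auto simp: U_def span_mul)
      then have "G \<theta>0 \<le> G ?u" by (rule \<theta>0(2))
      also have "G ?u = G \<theta> / norm \<theta>"
        unfolding G_def sum_divide_distrib
        by (rule sum.cong) (use False in \<open>auto simp: max_def field_simps\<close>)
      finally show ?thesis using False by (simp add: field_simps)
    qed
    ultimately show thesis using that by blast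
  qed
  \<comment> \<open>Outside this ball \<open>F\<close> exceeds \<open>F 0\<close>, so a minimum over the ball is global on \<open>U\<close>.\<close>
  let ?K = "U \<inter> cball 0 (F 0 / \<delta>)"
  have F0: "F 0 \<ge> 0" by (simp add: F_def)
  have zero_K: "0 \<in> ?K" using F0 \<delta>(1) by (simp add: U_def span_0)
  have "compact ?K" using closedU by (simp add: closed_Int_compact)
  moreover have "continuous_on ?K F" unfolding F_def by (intro continuous_intros)
  ultimately obtain \<theta> where \<theta>: "\<theta> \<in> ?K" "\<And>\<eta>. \<eta> \<in> ?K \<Longrightarrow> F \<theta> \<le> F \<eta>"
    using continuous_attains_inf[of ?K F] zero_K by blast
  have min: "F \<theta> \<le> F \<eta>" if "\<eta> \<in> U" for \<eta>
  proof (cases "\<eta> \<in> ?K")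
    case False
    then have "F 0 / \<delta> < norm \<eta>" using that by simp
    then have "F 0 < \<delta> * norm \<eta>" using \<delta>(1) by (simp add: field_simps)
    also have "\<dots> \<le> F \<eta>" using \<delta>(2)[OF that] F_ge_G[of \<eta>] by simp
    finally show ?thesis using \<theta>(2)[OF zero_K] by simp
  qed (rule \<theta>(2))
  define v where "v = (\<Sum>i\<in>I. exp (\<theta> \<bullet> W i) *\<^sub>R W i)"
  have vU: "v \<in> U"
    unfolding v_def U_def by (intro span_sum span_mul span_base) auto
  have deriv: "((\<lambda>t. F (\<theta> + t *\<^sub>R v)) has_real_derivative v \<bullet> v) (at 0)"
  proof -
    have "((\<lambda>t. F (\<theta> + t *\<^sub>R v)) has_real_derivative
        (\<Sum>i\<in>I. exp (\<theta> \<bullet> W i) * (v \<bullet> W i))) (at 0)"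
      unfolding F_def inner_add_left inner_scaleR_left
      by (auto intro!: derivative_eq_intros sum.cong)
    also have "(\<Sum>i\<in>I. exp (\<theta> \<bullet> W i) * (v \<bullet> W i)) = v \<bullet> v"
      by (subst (3) v_def) (simp add: inner_sum_right)
    finally show ?thesis .
  qed
  have "v \<bullet> v = 0"
  proof (rule DERIV_local_min[OF deriv, of 1])
    show "\<forall>t. \<bar>0 - t\<bar> < 1 \<longrightarrow> F (\<theta> + 0 *\<^sub>R v) \<le> F (\<theta> + t *\<^sub>R v)"
      using \<theta>(1) vU by (auto intro!: min simp: U_def span_add span_mul)
  qed simp
  then show ?thesis unfolding v_def by auto
qed

section \<open>Elementary symmetric polynomials on the upper half-plane\<close>

definition elem_sym :: "('a \<Rightarrow> 'b::comm_semiring_1) \<Rightarrow> nat \<Rightarrow> 'a set \<Rightarrow> 'b" where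
  "elem_sym z k A = (\<Sum>B | B \<subseteq> A \<and> card B = k. \<Prod>j\<in>B. z j)"

lemma elem_sym_0 [simp]: "finite A \<Longrightarrow> elem_sym z 0 A = 1"
proof -
  assume "finite A"
  then have "{B. B \<subseteq> A \<and> card B = 0} = {{}}"
    by (auto dest: finite_subset)
  then show ?thesis by (simp add: elem_sym_def)
qed

lemma sum_prod_subsets_containing:
  assumes "finite A" "x \<in> A"
  shows "(\<Sum>B | B \<subseteq> A \<and> card B = Suc k \<and> x \<in> B. \<Prod>j\<in>B. z j) = z x * elem_sym z k (A - {x})"
proof -
  have "(\<Sum>B | B \<subseteq> A \<and> card B = Suc k \<and> x \<in> B. \<Prod>j\<in>B. z j)
      = (\<Sum>C | C \<subseteq> A - {x} \<and> card C = k. z x * (\<Prod>j\<in>C. z j))"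
  proof (rule sum.reindex_bij_witness[where j = "\<lambda>B. B - {x}" and i = "insert x"])
    fix B assume B: "B \<in> {B. B \<subseteq> A \<and> card B = Suc k \<and> x \<in> B}"
    then have "finite B" using assms finite_subset by blast
    then show "z x * (\<Prod>j\<in>B - {x}. z j) = (\<Prod>j\<in>B. z j)"
      using B prod.remove[of B x z] by simp
    show "insert x (B - {x}) = B" "B - {x} \<in> {C. C \<subseteq> A - {x} \<and> card C = k}"
      using B by auto
  next
    fix C assume C: "C \<in> {C. C \<subseteq> A - {x} \<and> card C = k}"
    then have "finite C" using assms finite_subset by blast
    then show "insert x C \<in> {B. B \<subseteq> A \<and> card B = Suc k \<and> x \<in> B}" "insert x C - {x} = C"
      using C assms by (auto simp: card_insert_if)
  qed
  then show ?thesis by (simp add: elem_sym_def sum_distrib_left)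
qed

lemma elem_sym_remove:
  assumes "finite A" "x \<in> A"
  shows "elem_sym z (Suc k) A = elem_sym z (Suc k) (A - {x}) + z x * elem_sym z k (A - {x})"
proof -
  have "{B. B \<subseteq> A \<and> card B = Suc k} =
      {B. B \<subseteq> A - {x} \<and> card B = Suc k} \<union> {B. B \<subseteq> A \<and> card B = Suc k \<and> x \<in> B}"
    by auto
  moreover have "finite {B. B \<subseteq> A - {x} \<and> card B = Suc k}"
      "finite {B. B \<subseteq> A \<and> card B = Suc k \<and> x \<in> B}"
    by (rule finite_subset[of _ "Pow A"]; use assms in auto)+
  ultimately have "elem_sym z (Suc k) A = elem_sym z (Suc k) (A - {x}) +
      (\<Sum>B | B \<subseteq> A \<and> card B = Suc k \<and> x \<in> B. \<Prod>j\<in>B. z j)"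
    unfolding elem_sym_def by (simp only:, subst sum.union_disjoint) auto
  then show ?thesis by (simp only: sum_prod_subsets_containing[OF assms])
qed

text \<open>
  Double counting: each product over a set of \<open>k + 1\<close> elements arises once for every choice of
  the element split off.
\<close>
lemma elem_sym_Suc_remove_one:
  assumes "finite A"
  shows "of_nat (Suc k) * elem_sym z (Suc k) A = (\<Sum>x\<in>A. z x * elem_sym z k (A - {x}))"
proof -
  let ?S = "{B. B \<subseteq> A \<and> card B = Suc k}"
  have fin: "finite ?S" by (rule finite_subset[of _ "Pow A"]) (use assms in auto)
  have "(\<Sum>x\<in>A. z x * elem_sym z k (A - {x})) =
      (\<Sum>x\<in>A. \<Sum>B | B \<in> ?S \<and> x \<in> B. \<Prod>j\<in>B. z j)"
    using assms by (intro sum.cong) (auto simp: sum_prod_subsets_containing[symmetric] conj_assoc)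
  also have "\<dots> = (\<Sum>B\<in>?S. \<Sum>x | x \<in> A \<and> x \<in> B. \<Prod>j\<in>B. z j)"
    by (rule sum.swap_restrict[OF assms fin])
  also have "\<dots> = (\<Sum>B\<in>?S. of_nat (Suc k) * (\<Prod>j\<in>B. z j))"
  proof (rule sum.cong)
    fix B assume "B \<in> ?S"
    then have "{x. x \<in> A \<and> x \<in> B} = B" "card B = Suc k" by auto
    then show "(\<Sum>x | x \<in> A \<and> x \<in> B. \<Prod>j\<in>B. z j) = of_nat (Suc k) * (\<Prod>j\<in>B. z j)"
      by simp
  qed simp
  also have "\<dots> = of_nat (Suc k) * elem_sym z (Suc k) A"
    unfolding elem_sym_def by (rule sum_distrib_left[symmetric])
  finally show ?thesis by simp
qed

lemma Im_inverse_neg_iff: "Im (inverse z) < 0 \<longleftrightarrow> Im z > 0"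
proof (cases "z = 0")
  case False
  then have "(Re z)\<^sup>2 + (Im z)\<^sup>2 > 0"
    by (simp add: complex_neq_0)
  then show ?thesis by (auto simp: divide_less_0_iff zero_less_divide_iff)
qed simp

text \<open>
  Write \<open>e k A\<close> for the symmetric polynomial. Splitting off one variable in the numerator, and
  then the same variable in the denominator, gives
  \<open>(k + 2) * e (k + 2) A / e (k + 1) A = (\<Sum>x\<in>A. 1 / (1 / z x + 1 / R x))\<close> with
  \<open>R x = e (k + 1) (A - {x}) / e k (A - {x})\<close>. Since inversion swaps the two open half-planes,
  each summand has positive imaginary part as soon as \<open>R x\<close> does, which makes an induction on
  the degree work.
\<close>
lemma Im_elem_sym_ratio_pos:
  fixes z :: "'a \<Rightarrow> complex"
  assumes "finite A" "k < card A" "\<And>j. j \<in> A \<Longrightarrow> Im (z j) > 0"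
  shows "elem_sym z k A \<noteq> 0 \<and> Im (elem_sym z (Suc k) A / elem_sym z k A) > 0"
  using assms
proof (induction k arbitrary: A)
  case 0
  then have "A \<noteq> {}" by auto
  have "elem_sym z (Suc 0) A = (\<Sum>x\<in>A. z x)"
    using elem_sym_Suc_remove_one[of A 0 z] 0 by simp
  moreover have "(\<Sum>x\<in>A. Im (z x)) > 0"
    using 0 \<open>A \<noteq> {}\<close> by (intro sum_pos) auto
  ultimately show ?case using 0 by simp
next
  case (Suc k)
  have nz: "elem_sym z (Suc k) A \<noteq> 0"
    using Suc.IH[of A] Suc.prems by auto
  have "A \<noteq> {}" using Suc.prems by auto
  have term_pos: "Im (z x * elem_sym z (Suc k) (A - {x}) / elem_sym z (Suc k) A) > 0"
    if x: "x \<in> A" for x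
  proof -
    let ?a = "elem_sym z (Suc k) (A - {x})" and ?b = "elem_sym z k (A - {x})"
    have IH: "?b \<noteq> 0" "Im (?a / ?b) > 0"
      using Suc.IH[of "A - {x}"] Suc.prems x by auto
    then have "?a \<noteq> 0" by auto
    have zx: "Im (z x) > 0" using Suc.prems x by auto
    then have "z x \<noteq> 0" by auto
    have "Im (inverse (z x) + inverse (?a / ?b)) < 0"
      using zx IH Im_inverse_neg_iff[of "z x"] Im_inverse_neg_iff[of "?a / ?b"]
      unfolding plus_complex.sel by linarith
    moreover have "inverse (z x) + inverse (?a / ?b) = (?a + z x * ?b) / (z x * ?a)"
      using \<open>?a \<noteq> 0\<close> \<open>z x \<noteq> 0\<close> IH by (simp add: field_simps)
    moreover have "?a + z x * ?b = elem_sym z (Suc k) A"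
      using elem_sym_remove[OF Suc.prems(1) x, of z k] by simp
    ultimately have "Im (inverse (z x * ?a / elem_sym z (Suc k) A)) < 0"
      by (simp only: inverse_divide)
    then show ?thesis by (simp only: Im_inverse_neg_iff)
  qed
  have "of_nat (Suc (Suc k)) * (elem_sym z (Suc (Suc k)) A / elem_sym z (Suc k) A)
      = (\<Sum>x\<in>A. z x * elem_sym z (Suc k) (A - {x}) / elem_sym z (Suc k) A)"
    using elem_sym_Suc_remove_one[OF Suc.prems(1), of "Suc k" z]
    by (simp add: sum_divide_distrib[symmetric] del: of_nat_Suc)
  moreover have "Im (\<Sum>x\<in>A. z x * elem_sym z (Suc k) (A - {x}) / elem_sym z (Suc k) A) > 0"
    unfolding Im_sum using Suc.prems(1) \<open>A \<noteq> {}\<close> term_pos by (rule sum_pos)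
  ultimately have "Im (of_nat (Suc (Suc k)) * (elem_sym z (Suc (Suc k)) A / elem_sym z (Suc k) A)) > 0"
    by simp
  moreover have "Im (of_nat n * w) = real n * Im w" for n w by simp
  ultimately have "real (Suc (Suc k)) * Im (elem_sym z (Suc (Suc k)) A / elem_sym z (Suc k) A) > 0"
    by metis
  then have "Im (elem_sym z (Suc (Suc k)) A / elem_sym z (Suc k) A) > 0"
    by (rule zero_less_mult_pos) simp
  then show ?case using nz by blast
qed

lemma elem_sym_nonzero:
  fixes z :: "'a \<Rightarrow> complex"
  assumes "finite A" "k \<le> card A" "\<And>j. j \<in> A \<Longrightarrow> Im (z j) > 0"
  shows "elem_sym z k A \<noteq> 0"
proof (cases k)
  case (Suc l)
  then show ?thesis using Im_elem_sym_ratio_pos[of A l z] assms by auto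
qed (use assms in simp)

text \<open>The sum can vanish only if the ratio of the two terms is \<open>-1\<close>, which is real.\<close>
lemma elem_sym_consecutive_sum_nonzero:
  fixes z :: "'a \<Rightarrow> complex"
  assumes "finite A" "k < card A" "\<And>j. j \<in> A \<Longrightarrow> Im (z j) > 0"
  shows "elem_sym z k A + elem_sym z (Suc k) A \<noteq> 0"
proof
  have r: "elem_sym z k A \<noteq> 0" "Im (elem_sym z (Suc k) A / elem_sym z k A) > 0"
    using Im_elem_sym_ratio_pos[of A k z] assms by auto
  assume "elem_sym z k A + elem_sym z (Suc k) A = 0"
  then have "elem_sym z (Suc k) A = - elem_sym z k A"
    by (simp add: add_eq_0_iff)
  then have "elem_sym z (Suc k) A / elem_sym z k A = -1" using r(1) by simp
  with r(2) show False by simp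
qed

section \<open>Conditional Bernoulli distributions are strongly Rayleigh\<close>

lemma num_ones_eq_card: "num_ones i = card {j. i j}"
  by (simp add: num_ones_def Collect_conj_eq)

lemma exists_num_ones:
  assumes "m \<le> CARD('n)"
  shows "\<exists>i :: 'n::finite \<Rightarrow> bool. num_ones i = m"
proof -
  obtain T :: "'n set" where "card T = m"
    using obtain_subset_with_card_n[OF assms] by blast
  then show ?thesis by (intro exI[of _ "\<lambda>j. j \<in> T"]) (simp add: num_ones_eq_card)
qed

lemma sum_num_ones_eq_elem_sym:
  fixes z :: "'n::finite \<Rightarrow> 'b::comm_semiring_1"
  shows "(\<Sum>i | num_ones i = m. \<Prod>j | i j. z j) = elem_sym z m UNIV"
  unfolding elem_sym_def
  by (rule sum.reindex_bij_witness[where j = Collect and i = "\<lambda>B j. j \<in> B"])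
     (auto simp: num_ones_eq_card)

text \<open>
  The independent vector has a pmf proportional to the product of the odds \<open>\<pi> j / (1 - \<pi> j)\<close>
  over the successes \<open>j\<close>, and conditioning only restricts it and rescales it. The odds range
  over all positive numbers, so every positive product weight occurs.
\<close>
lemma pmf_conditional_bernoulli:
  fixes \<pi> :: "'n::finite \<Rightarrow> real"
  assumes \<pi>: "\<And>j. 0 < \<pi> j \<and> \<pi> j < 1" and "S \<noteq> {}"
  shows "\<exists>c>0. \<forall>i. pmf (cond_pmf (indep_bernoulli \<pi>) S) i =
    (if i \<in> S then c * (\<Prod>j | i j. \<pi> j / (1 - \<pi> j)) else 0)"
proof -
  let ?Q = "indep_bernoulli \<pi>"
  have Q: "pmf ?Q i = (\<Prod>j\<in>UNIV. 1 - \<pi> j) * (\<Prod>j | i j. \<pi> j / (1 - \<pi> j))" for i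
  proof -
    have "pmf ?Q i = (\<Prod>j\<in>UNIV. pmf (bernoulli_pmf (\<pi> j)) (i j))"
      unfolding indep_bernoulli_def by (subst pmf_Pi) auto
    also have "\<dots> = (\<Prod>j\<in>UNIV. (1 - \<pi> j) * (if i j then \<pi> j / (1 - \<pi> j) else 1))"
    proof (rule prod.cong)
      fix j
      show "pmf (bernoulli_pmf (\<pi> j)) (i j) = (1 - \<pi> j) * (if i j then \<pi> j / (1 - \<pi> j) else 1)"
        using \<pi>[of j] by (cases "i j") auto
    qed simp
    finally show ?thesis
      by (simp add: prod.distrib prod.inter_filter[symmetric])
  qed
  have D: "(\<Prod>j\<in>UNIV. 1 - \<pi> j) > 0" using \<pi> by (intro prod_pos) auto
  have Qpos: "pmf ?Q i > 0" for i
    unfolding Q using \<pi> by (intro mult_pos_pos D prod_pos) auto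
  then have set: "set_pmf ?Q = UNIV" by (metis UNIV_eq_I less_irrefl set_pmf_iff)
  obtain x where x: "x \<in> S" using assms by blast
  have Spos: "measure (measure_pmf ?Q) S > 0"
    using x set by (simp add: measure_pmf_posI)
  show ?thesis
  proof (intro exI[of _ "(\<Prod>j\<in>UNIV. 1 - \<pi> j) / measure (measure_pmf ?Q) S"] conjI allI)
    fix i
    have ne: "set_pmf ?Q \<inter> S \<noteq> {}" using set x by auto
    show "pmf (cond_pmf ?Q S) i = (if i \<in> S
        then (\<Prod>j\<in>UNIV. 1 - \<pi> j) / measure (measure_pmf ?Q) S * (\<Prod>j | i j. \<pi> j / (1 - \<pi> j)) else 0)"
      unfolding pmf_cond[OF ne] Q by simp
  qed (use D Spos in simp)
qed

text \<open>
  The generating function is a positive multiple of an elementary symmetric polynomial, or of the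
  sum of two consecutive ones, in the variables \<open>z j\<close> rescaled by the positive odds; the
  rescaling preserves the upper half-plane.
\<close>
lemma conditional_bernoulli_imp_strongly_rayleigh:
  fixes f :: "('n::finite \<Rightarrow> bool) pmf"
  assumes "conditional_bernoulli f"
  shows "strongly_rayleigh f"
  unfolding strongly_rayleigh_def stable_def
proof (intro allI impI)
  fix z :: "'n \<Rightarrow> complex"
  assume z: "\<forall>j. 0 < Im (z j)"
  obtain \<pi> :: "'n \<Rightarrow> real" and S where \<pi>: "\<And>j. 0 < \<pi> j \<and> \<pi> j < 1"
    and f: "f = cond_pmf (indep_bernoulli \<pi>) S"
    and S: "(\<exists>m \<in> {0..CARD('n)}. S = {k. num_ones k = m}) \<or>
         (\<exists>m \<in> {0..CARD('n) - 1}. S = {k. m \<le> num_ones k \<and> num_ones k \<le> m + 1})"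
    using assms unfolding conditional_bernoulli_def by blast
  define w where "w j = \<pi> j / (1 - \<pi> j)" for j
  define u where "u j = w j *\<^sub>R z j" for j
  have "w j > 0" for j using \<pi>[of j] by (simp add: w_def)
  then have u: "Im (u j) > 0" for j using z by (simp add: u_def)
  have ones: "\<exists>i :: 'n \<Rightarrow> bool. num_ones i = m" if "m \<in> {0..CARD('n)} \<or> m \<in> {0..CARD('n) - 1}" for m
    using that by (intro exists_num_ones) auto
  have "\<exists>m. (\<exists>i :: 'n \<Rightarrow> bool. num_ones i = m) \<and> {k. num_ones k = m} \<subseteq> S"
    using S
  proof (elim disjE bexE)
    fix m assume "m \<in> {0..CARD('n)}" "S = {k. num_ones k = m}"
    then show ?thesis using ones by blast
  next
    fix m assume "m \<in> {0..CARD('n) - 1}" "S = {k. m \<le> num_ones k \<and> num_ones k \<le> m + 1}"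
    then show ?thesis using ones[of m] by (intro exI[of _ m]) auto
  qed
  then have ne: "S \<noteq> {}" by blast
  obtain c where c: "c > 0"
    and pmf: "\<And>i. pmf f i = (if i \<in> S then c * (\<Prod>j | i j. w j) else 0)"
    using pmf_conditional_bernoulli[of \<pi>, OF \<pi> ne] unfolding f[symmetric] w_def[symmetric]
    by metis
  have "prob_gen_fun f z = (\<Sum>i\<in>UNIV. pmf f i *\<^sub>R (\<Prod>j\<in>UNIV. z j ^ (of_bool (i j) :: nat)))"
    unfolding prob_gen_fun_def by (rule integral_measure_pmf) auto
  also have "\<dots> = (\<Sum>i\<in>UNIV. if i \<in> S then c *\<^sub>R (\<Prod>j | i j. u j) else 0)"
  proof (rule sum.cong)
    fix i :: "'n \<Rightarrow> bool"
    have "(\<Prod>j\<in>UNIV. z j ^ (of_bool (i j) :: nat)) = (\<Prod>j\<in>UNIV. if i j then z j else 1)"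
      by (rule prod.cong) auto
    also have "\<dots> = (\<Prod>j | i j. z j)" by (simp add: prod.inter_filter[symmetric])
    finally show "pmf f i *\<^sub>R (\<Prod>j\<in>UNIV. z j ^ (of_bool (i j) :: nat)) =
        (if i \<in> S then c *\<^sub>R (\<Prod>j | i j. u j) else 0)"
      by (simp add: pmf u_def scaleR_conv_of_real prod.distrib)
  qed simp
  also have "\<dots> = c *\<^sub>R (\<Sum>i\<in>S. \<Prod>j | i j. u j)"
    by (simp add: sum.If_cases scaleR_sum_right)
  finally have gen: "prob_gen_fun f z = c *\<^sub>R (\<Sum>i\<in>S. \<Prod>j | i j. u j)" .
  have "(\<Sum>i\<in>S. \<Prod>j | i j. u j) \<noteq> 0"
    using S
  proof (elim disjE bexE)
    fix m assume m: "m \<in> {0..CARD('n)}" and S: "S = {k. num_ones k = m}"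
    show ?thesis unfolding S sum_num_ones_eq_elem_sym
      using m u by (intro elem_sym_nonzero) auto
  next
    fix m assume m: "m \<in> {0..CARD('n) - 1}"
      and S: "S = {k. m \<le> num_ones k \<and> num_ones k \<le> m + 1}"
    have "m < CARD('n)" using m zero_less_card_finite[where 'a='n] by (auto simp del: zero_less_card_finite)
    have "S = {k. num_ones k = m} \<union> {k. num_ones k = Suc m}" unfolding S by auto
    then have "(\<Sum>i\<in>S. \<Prod>j | i j. u j) = elem_sym u m UNIV + elem_sym u (Suc m) UNIV"
      by (simp add: sum.union_disjoint disjoint_iff sum_num_ones_eq_elem_sym)
    also have "\<dots> \<noteq> 0"
      using u \<open>m < CARD('n)\<close> by (intro elem_sym_consecutive_sum_nonzero) auto
    finally show ?thesis .
  qed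
  then show "prob_gen_fun f z \<noteq> 0" using gen c by simp
qed

section \<open>The support of \<open>\<Sigma>\<close>-countermonotonic vectors\<close>

lemma countermonotonic_pmf_iff:
  fixes f :: "'a::finite pmf"
  shows "countermonotonic (measure_pmf f) X Y \<longleftrightarrow>
    (\<forall>a\<in>set_pmf f. \<forall>b\<in>set_pmf f. (X a - X b) * (Y a - Y b) \<le> 0)"
proof -
  interpret pair_sigma_finite "measure_pmf f" "measure_pmf f" ..
  have "sets (measure_pmf f \<Otimes>\<^sub>M measure_pmf f) =
      sets (count_space (UNIV :: 'a set) \<Otimes>\<^sub>M count_space (UNIV :: 'a set))"
    by (intro sets_pair_measure_cong) auto
  also have "\<dots> = UNIV"
    by (subst pair_measure_countable) auto
  finally have sets: "sets (measure_pmf f \<Otimes>\<^sub>M measure_pmf f) = UNIV" .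
  have "(AE x in measure_pmf f \<Otimes>\<^sub>M measure_pmf f. case x of (a, b) \<Rightarrow> (X a - X b) * (Y a - Y b) \<le> 0)
     \<longleftrightarrow> (AE a in measure_pmf f. AE b in measure_pmf f. (X a - X b) * (Y a - Y b) \<le> 0)"
    by (subst AE_pair_iff) (auto simp: sets_eq_imp_space_eq sets case_prod_beta)
  then show ?thesis
    unfolding countermonotonic_def by (simp add: AE_measure_pmf_iff)
qed

lemma real_num_ones_split:
  "real (num_ones i) = (\<Sum>j\<in>\<Lambda>. of_bool (i j)) + (\<Sum>j\<in>-\<Lambda>. of_bool (i j))"
proof -
  have "real (num_ones i) = (\<Sum>j\<in>UNIV. of_bool (i j))"
    by (simp add: num_ones_def)
  also have "\<dots> = (\<Sum>j\<in>\<Lambda>. of_bool (i j)) + (\<Sum>j\<in>-\<Lambda>. of_bool (i j))"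
    by (subst sum.union_disjoint[symmetric]) auto
  finally show ?thesis .
qed

text \<open>
  For two support points, let \<open>x\<close> and \<open>y\<close> be the differences of the partial sums over \<open>\<Lambda>\<close> and
  over its complement, so that \<open>x + y\<close> is the difference of the totals. Two integers of the same
  strict sign have a sum of absolute value at least 2, so totals that differ by at most 1 force
  \<open>x * y \<le> 0\<close>. Conversely, if the total of \<open>a\<close> exceeds that of \<open>b\<close> by 2 or more, a single
  coordinate where \<open>a\<close> is 1 and \<open>b\<close> is 0 serves as \<open>\<Lambda>\<close> and leaves a positive difference on
  its complement.
\<close>
lemma sigma_countermonotonic_iff:
  fixes f :: "('n::finite \<Rightarrow> bool) pmf"
  shows "sigma_countermonotonic f \<longleftrightarrow>
    (\<forall>a\<in>set_pmf f. \<forall>b\<in>set_pmf f. num_ones a \<le> num_ones b + 1)"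
proof (intro iffI ballI)
  fix a b assume f: "sigma_countermonotonic f" and ab: "a \<in> set_pmf f" "b \<in> set_pmf f"
  show "num_ones a \<le> num_ones b + 1"
  proof (rule ccontr)
    assume gt: "\<not> num_ones a \<le> num_ones b + 1"
    have "\<exists>j. a j \<and> \<not> b j"
    proof (rule ccontr)
      assume "\<not> (\<exists>j. a j \<and> \<not> b j)"
      then have "num_ones a \<le> num_ones b"
        unfolding num_ones_eq_card by (intro card_mono) auto
      with gt show False by simp
    qed
    then obtain j where j: "a j" "\<not> b j" by blast
    have "((\<Sum>j\<in>{j}. of_bool (a j)) - (\<Sum>j\<in>{j}. of_bool (b j))) *
      ((\<Sum>j\<in>-{j}. of_bool (a j)) - (\<Sum>j\<in>-{j}. of_bool (b j))) \<le> (0::real)"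
      using f ab unfolding sigma_countermonotonic_def countermonotonic_pmf_iff by blast
    then have "(\<Sum>j\<in>-{j}. of_bool (a j)) \<le> (\<Sum>j\<in>-{j}. of_bool (b j) :: real)"
      using j by simp
    then have "real (num_ones a) \<le> real (num_ones b) + 1"
      using j real_num_ones_split[of a "{j}"] real_num_ones_split[of b "{j}"] by simp
    with gt show False by linarith
  qed
next
  assume *: "\<forall>a\<in>set_pmf f. \<forall>b\<in>set_pmf f. num_ones a \<le> num_ones b + 1"
  show "sigma_countermonotonic f"
    unfolding sigma_countermonotonic_def countermonotonic_pmf_iff
  proof (intro allI ballI)
    fix \<Lambda> a b assume "a \<in> set_pmf f" "b \<in> set_pmf f"
    then have le: "real (num_ones a) \<le> real (num_ones b) + 1" "real (num_ones b) \<le> real (num_ones a) + 1"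
      using * by (metis of_nat_1 of_nat_add of_nat_le_iff)+
    define x :: int where "x = (\<Sum>j\<in>\<Lambda>. of_bool (a j)) - (\<Sum>j\<in>\<Lambda>. of_bool (b j))"
    define y :: int where "y = (\<Sum>j\<in>-\<Lambda>. of_bool (a j)) - (\<Sum>j\<in>-\<Lambda>. of_bool (b j))"
    have xr: "real_of_int x = (\<Sum>j\<in>\<Lambda>. of_bool (a j)) - (\<Sum>j\<in>\<Lambda>. of_bool (b j))"
      and yr: "real_of_int y = (\<Sum>j\<in>-\<Lambda>. of_bool (a j)) - (\<Sum>j\<in>-\<Lambda>. of_bool (b j))"
      by (simp_all add: x_def y_def)
    have "real_of_int (x + y) \<le> 1" "real_of_int (x + y) \<ge> -1"
      using le real_num_ones_split[of a \<Lambda>] real_num_ones_split[of b \<Lambda>] xr yr by auto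
    then have "x + y \<le> 1" "x + y \<ge> -1" by linarith+
    then have "x \<le> 0 \<and> y \<ge> 0 \<or> x \<ge> 0 \<and> y \<le> 0" by linarith
    then have "x * y \<le> 0" by (auto simp: mult_le_0_iff)
    then have "real_of_int x * real_of_int y \<le> 0"
      by (metis of_int_le_0_iff of_int_mult)
    then show "((\<Sum>j\<in>\<Lambda>. of_bool (a j)) - (\<Sum>j\<in>\<Lambda>. of_bool (b j))) *
      ((\<Sum>j\<in>-\<Lambda>. of_bool (a j)) - (\<Sum>j\<in>-\<Lambda>. of_bool (b j))) \<le> (0::real)"
      by (simp only: xr yr)
  qed
qed

lemma bernoulli_class_iff:
  fixes p :: "'n::finite \<Rightarrow> real"
  assumes p: "\<And>j. 0 < p j \<and> p j < 1"
  shows "f \<in> bernoulli_class p \<longleftrightarrow> (\<forall>j. (\<Sum>i\<in>UNIV. pmf f i * of_bool (i j)) = p j)"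
proof -
  have "map_pmf (\<lambda>i. i j) f = bernoulli_pmf (p j) \<longleftrightarrow>
      (\<Sum>i\<in>UNIV. pmf f i * of_bool (i j)) = p j" for j
  proof -
    have T: "pmf (map_pmf (\<lambda>i. i j) f) True = (\<Sum>i\<in>UNIV. pmf f i * of_bool (i j))"
    proof -
      have "pmf (map_pmf (\<lambda>i. i j) f) True = (\<Sum>i | i j. pmf f i)"
        unfolding pmf_map by (simp add: vimage_def measure_measure_pmf_finite)
      also have "\<dots> = (\<Sum>i\<in>UNIV. pmf f i * of_bool (i j))"
        by (simp add: of_bool_def if_distrib sum.If_cases cong: if_cong)
      finally show ?thesis .
    qed
    have "map_pmf (\<lambda>i. i j) f = bernoulli_pmf (p j) \<longleftrightarrow>
      pmf (map_pmf (\<lambda>i. i j) f) True = pmf (bernoulli_pmf (p j)) True"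
    proof
      assume eq: "pmf (map_pmf (\<lambda>i. i j) f) True = pmf (bernoulli_pmf (p j)) True"
      show "map_pmf (\<lambda>i. i j) f = bernoulli_pmf (p j)"
      proof (rule pmf_eqI)
        fix b
        show "pmf (map_pmf (\<lambda>i. i j) f) b = pmf (bernoulli_pmf (p j)) b"
          using eq by (cases b) (simp_all add: pmf_False_conv_True)
      qed
    qed simp
    then show ?thesis using T p[of j] by simp
  qed
  then show ?thesis by (simp add: bernoulli_class_def)
qed

lemma sum_pmf_UNIV: "(\<Sum>i\<in>UNIV. pmf f i) = 1" for f :: "'a::finite pmf"
  by (rule sum_pmf_eq_1) auto

lemma mean_num_ones:
  fixes p :: "'n::finite \<Rightarrow> real"
  assumes "\<And>j. (\<Sum>i\<in>UNIV. pmf f i * of_bool (i j)) = p j"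
  shows "(\<Sum>i\<in>UNIV. pmf f i * (real (num_ones i) - (\<Sum>j\<in>UNIV. p j))) = 0"
proof -
  have "(\<Sum>i\<in>UNIV. pmf f i * real (num_ones i)) = (\<Sum>i\<in>UNIV. \<Sum>j\<in>UNIV. pmf f i * of_bool (i j))"
    unfolding num_ones_def of_nat_sum sum_distrib_left by simp
  also have "\<dots> = (\<Sum>j\<in>UNIV. \<Sum>i\<in>UNIV. pmf f i * of_bool (i j))"
    by (rule sum.swap)
  also have "\<dots> = (\<Sum>j\<in>UNIV. p j)" using assms by simp
  finally show ?thesis
    by (simp add: right_diff_distrib sum_subtractf sum_pmf_UNIV flip: sum_distrib_right)
qed

text \<open>
  The vectors whose total is the mean total \<open>s\<close>, rounded down or up. The strict inequality makes
  this a single slice when \<open>s\<close> is an integer and two neighbouring slices otherwise.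
\<close>
definition central_slices :: "('n::finite \<Rightarrow> real) \<Rightarrow> ('n \<Rightarrow> bool) set" where
  "central_slices p = {k. \<bar>real (num_ones k) - (\<Sum>j\<in>UNIV. p j)\<bar> < 1}"

lemma pmf_mean_zero_nonneg_imp_zero:
  fixes f :: "'a::finite pmf" and h :: "'a \<Rightarrow> real"
  assumes "(\<Sum>i\<in>UNIV. pmf f i * h i) = 0" "\<And>i. i \<in> set_pmf f \<Longrightarrow> h i \<ge> 0" "i \<in> set_pmf f"
  shows "h i = 0"
proof -
  have "\<forall>i\<in>UNIV. pmf f i * h i \<ge> 0"
    using assms(2) by (metis mult_eq_0_iff mult_nonneg_nonneg order_refl pmf_nonneg set_pmf_iff)
  then have "\<forall>i\<in>UNIV. pmf f i * h i = 0"
    using assms(1) by (subst (asm) sum_nonneg_eq_0_iff) auto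
  then show ?thesis using assms(3) by (auto simp: set_pmf_iff)
qed

text \<open>
  The totals in the support differ pairwise by at most 1. If one of them were at least \<open>s + 1\<close>,
  all would be at least their mean \<open>s\<close>, hence equal to it, which is absurd; the case of a
  total of at most \<open>s - 1\<close> is symmetric.
\<close>
lemma sigma_class_eq:
  fixes p :: "'n::finite \<Rightarrow> real"
  assumes p: "\<And>j. 0 < p j \<and> p j < 1"
  shows "sigma_class p = {f \<in> bernoulli_class p. set_pmf f \<subseteq> central_slices p}"
proof -
  let ?s = "\<Sum>j\<in>UNIV. p j"
  have "sigma_countermonotonic f \<longleftrightarrow> set_pmf f \<subseteq> central_slices p" if f: "f \<in> bernoulli_class p" for f
  proof
    assume sc: "sigma_countermonotonic f"
    have mean: "(\<Sum>i\<in>UNIV. pmf f i * (real (num_ones i) - ?s)) = 0"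
      using f by (intro mean_num_ones) (simp add: bernoulli_class_iff[OF p])
    show "set_pmf f \<subseteq> central_slices p"
    proof
      fix a assume a: "a \<in> set_pmf f"
      have near: "real (num_ones a) \<le> real (num_ones b) + 1" "real (num_ones b) \<le> real (num_ones a) + 1"
        if "b \<in> set_pmf f" for b
        using sc a that unfolding sigma_countermonotonic_iff
        by (metis of_nat_1 of_nat_add of_nat_le_iff)+
      have "\<not> real (num_ones a) \<ge> ?s + 1"
      proof
        assume ge: "real (num_ones a) \<ge> ?s + 1"
        have "real (num_ones a) - ?s = 0"
          by (rule pmf_mean_zero_nonneg_imp_zero[OF mean _ a]) (use near ge in force)
        with ge show False by simp
      qed
      moreover have "\<not> real (num_ones a) \<le> ?s - 1"
      proof
        assume le: "real (num_ones a) \<le> ?s - 1"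
        have mean': "(\<Sum>i\<in>UNIV. pmf f i * (?s - real (num_ones i))) = 0"
          using mean by (simp add: right_diff_distrib sum_subtractf)
        have "?s - real (num_ones a) = 0"
          by (rule pmf_mean_zero_nonneg_imp_zero[OF mean' _ a]) (use near le in force)
        with le show False by simp
      qed
      ultimately show "a \<in> central_slices p" unfolding central_slices_def by auto
    qed
  next
    assume sub: "set_pmf f \<subseteq> central_slices p"
    show "sigma_countermonotonic f"
      unfolding sigma_countermonotonic_iff
    proof (intro ballI)
      fix a b assume "a \<in> set_pmf f" "b \<in> set_pmf f"
      then have "\<bar>real (num_ones a) - ?s\<bar> < 1" "\<bar>real (num_ones b) - ?s\<bar> < 1"
        using sub by (auto simp: central_slices_def)
      then have "real (num_ones a) < real (num_ones b) + 2" by linarith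
      then show "num_ones a \<le> num_ones b + 1" by linarith
    qed
  qed
  then show ?thesis by (auto simp: sigma_class_def)
qed

lemma sum_marginals_bounds:
  fixes p :: "'n::finite \<Rightarrow> real"
  assumes p: "\<And>j. 0 < p j \<and> p j < 1"
  shows "(\<Sum>j\<in>UNIV. p j) > 0" "(\<Sum>j\<in>UNIV. p j) < real CARD('n)"
proof -
  show "(\<Sum>j\<in>UNIV. p j) > 0" using p by (intro sum_pos) auto
  have "(\<Sum>j\<in>UNIV. p j) < (\<Sum>j\<in>(UNIV::'n set). 1)" using p by (intro sum_strict_mono) auto
  then show "(\<Sum>j\<in>UNIV. p j) < real CARD('n)" by simp
qed

lemma central_slices_cases:
  fixes p :: "'n::finite \<Rightarrow> real"
  assumes p: "\<And>j. 0 < p j \<and> p j < 1"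
  shows "\<exists>m<CARD('n). \<exists>r. 0 \<le> r \<and> r < 1 \<and> (\<Sum>j\<in>UNIV. p j) = real m + r \<and>
    central_slices p = (if r = 0 then {k. num_ones k = m}
      else {k. m \<le> num_ones k \<and> num_ones k \<le> m + 1})"
proof -
  let ?s = "\<Sum>j\<in>UNIV. p j"
  define m where "m = nat \<lfloor>?s\<rfloor>"
  define r where "r = ?s - real m"
  note b = sum_marginals_bounds[of p, OF p]
  have m: "real m = of_int \<lfloor>?s\<rfloor>" using b by (simp add: m_def)
  have r: "0 \<le> r" "r < 1" unfolding r_def m by linarith+
  have "m < CARD('n)" using b(2) r unfolding r_def by linarith
  moreover have "central_slices p = (if r = 0 then {k. num_ones k = m}
      else {k. m \<le> num_ones k \<and> num_ones k \<le> m + 1})"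
  proof (cases "r = 0")
    case True
    then have "?s = real m" by (simp add: r_def)
    then show ?thesis using True by (auto simp: central_slices_def)
  next
    case False
    have s: "?s = real m + r" by (simp add: r_def)
    have "\<bar>real (num_ones k) - ?s\<bar> < 1 \<longleftrightarrow> m \<le> num_ones k \<and> num_ones k \<le> m + 1" for k :: "'n \<Rightarrow> bool"
      unfolding s using False r by linarith
    then show ?thesis using False by (simp add: central_slices_def)
  qed
  ultimately show ?thesis using r by (intro exI[of _ m] conjI exI[of _ r]) (auto simp: r_def)
qed

lemma central_slices_nonempty:
  fixes p :: "'n::finite \<Rightarrow> real"
  assumes p: "\<And>j. 0 < p j \<and> p j < 1"
  shows "central_slices p \<noteq> {}"
proof -
  obtain m r where m: "m < CARD('n)"
    and S: "central_slices p = (if r = (0::real) then {k. num_ones k = m}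
      else {k. m \<le> num_ones k \<and> num_ones k \<le> m + 1})"
    using central_slices_cases[of p, OF p] by blast
  obtain i :: "'n \<Rightarrow> bool" where "num_ones i = m"
    using exists_num_ones[where 'n = 'n, of m] m by auto
  then have "i \<in> central_slices p" by (simp add: S)
  then show ?thesis by blast
qed

section \<open>The marginal vector is a relative interior point\<close>

lemma exists_top_set:
  fixes \<theta> :: "'n::finite \<Rightarrow> real"
  shows "m \<le> CARD('n) \<Longrightarrow> \<exists>T. card T = m \<and> (\<forall>a\<in>T. \<forall>b\<in>-T. \<theta> b \<le> \<theta> a)"
proof (induction m)
  case 0
  then show ?case by (intro exI[of _ "{}"]) auto
next
  case (Suc m)
  then obtain T where T: "card T = m" "\<forall>a\<in>T. \<forall>b\<in>-T. \<theta> b \<le> \<theta> a" by auto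
  then have "T \<noteq> UNIV" using Suc by auto
  then have "-T \<noteq> {}" by blast
  then obtain k where k: "k \<in> -T" "Max (\<theta> ` (-T)) = \<theta> k"
    by (rule obtains_MAX[OF finite])
  then have kmax: "\<theta> b \<le> \<theta> k" if "b \<in> -T" for b
    using that by (metis Max_ge finite finite_imageI imageI)
  show ?case using T k(1) kmax by (intro exI[of _ "insert k T"]) auto
qed

text \<open>
  With \<open>r\<close> the fractional part of \<open>\<Sum>j. p j\<close>, compare \<open>p\<close> with the mixture, of weights
  \<open>1 - r\<close> and \<open>r\<close>, of the indicators of the \<open>m\<close> and of the \<open>m + 1\<close> coordinates on which \<open>\<theta>\<close> is
  largest. Both have the same total, so \<open>\<theta>\<close> may be shifted by the \<open>(m + 1)\<close>-st largest value
  \<open>\<tau>\<close>, after which each coordinate contributes a nonnegative amount to the difference. As \<open>p\<close>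
  lies in the open cube, the difference vanishes only if \<open>\<theta>\<close> is constant. For constant \<open>\<theta>\<close> the functional
  vanishes on a single slice; on two slices its values are \<open>- (\<tau> * r)\<close> and \<open>\<tau> * (1 - r)\<close>,
  so the upper bound forces \<open>\<tau> = 0\<close>.
\<close>
lemma central_slices_relative_interior:
  fixes p \<theta> :: "'n::finite \<Rightarrow> real"
  assumes p: "\<And>j. 0 < p j \<and> p j < 1"
    and le: "\<And>i. i \<in> central_slices p \<Longrightarrow> (\<Sum>j\<in>UNIV. \<theta> j * (of_bool (i j) - p j)) \<le> 0"
    and i: "i \<in> central_slices p"
  shows "(\<Sum>j\<in>UNIV. \<theta> j * (of_bool (i j) - p j)) = 0"
proof -
  let ?s = "\<Sum>j\<in>UNIV. p j"
  obtain m r where m: "m < CARD('n)" and r: "0 \<le> r" "r < 1" and s: "?s = real m + r"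
    and S: "central_slices p = (if r = 0 then {k. num_ones k = m}
      else {k. m \<le> num_ones k \<and> num_ones k \<le> m + 1})"
    using central_slices_cases[of p, OF p] by blast
  obtain T where T: "card T = m" "\<forall>a\<in>T. \<forall>b\<in>-T. \<theta> b \<le> \<theta> a"
    using exists_top_set[of m \<theta>] m by auto
  then have "T \<noteq> UNIV" using m by auto
  then have "-T \<noteq> {}" by blast
  define \<tau> where "\<tau> = Max (\<theta> ` (-T))"
  have "\<tau> \<in> \<theta> ` (-T)" unfolding \<tau>_def using \<open>-T \<noteq> {}\<close> by (intro Max_in) auto
  then obtain k where k: "k \<notin> T" "\<tau> = \<theta> k" by auto
  have out: "\<theta> j \<le> \<tau>" if "j \<notin> T" for j using that by (simp add: \<tau>_def)
  have ins: "\<tau> \<le> \<theta> j" if "j \<in> T" for j using that T k by auto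
  define L where "L i = (\<Sum>j\<in>UNIV. \<theta> j * (of_bool (i j) - p j))" for i :: "'n \<Rightarrow> bool"
  have L_alt: "L i = (\<Sum>j\<in>UNIV. (\<theta> j - \<tau>) * (of_bool (i j) - p j)) + \<tau> * (real (num_ones i) - ?s)" for i
    by (simp add: L_def num_ones_def algebra_simps sum.distrib sum_subtractf sum_distrib_left sum_distrib_right)
  have T0: "num_ones (\<lambda>j. j \<in> T) = m" and T1: "num_ones (\<lambda>j. j \<in> insert k T) = m + 1"
    using T k unfolding num_ones_eq_card Collect_mem_eq by simp_all
  \<comment> \<open>\<open>k\<close> has the \<open>(m + 1)\<close>-st largest value \<open>\<tau>\<close>, so it adds nothing after the shift by \<open>\<tau>\<close>.\<close>
  have LT1: "L (\<lambda>j. j \<in> insert k T) = L (\<lambda>j. j \<in> T) + \<tau>"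
  proof -
    have "(\<Sum>j\<in>UNIV. (\<theta> j - \<tau>) * (of_bool (j \<in> insert k T) - p j)) =
        (\<Sum>j\<in>UNIV. (\<theta> j - \<tau>) * (of_bool (j \<in> T) - p j))"
      by (rule sum.cong) (auto simp: k)
    then show ?thesis unfolding L_alt T0 T1 by (simp add: algebra_simps)
  qed
  have "L (\<lambda>j. j \<in> T) + r * \<tau> \<le> 0"
  proof (cases "r = 0")
    case True
    then show ?thesis using le[of "\<lambda>j. j \<in> T"] T0 by (simp add: L_def S)
  next
    case False
    have "L (\<lambda>j. j \<in> T) \<le> 0" "L (\<lambda>j. j \<in> insert k T) \<le> 0"
      unfolding L_def by (rule le; use S False T0 T1 in simp)+
    then have "(1 - r) * L (\<lambda>j. j \<in> T) + r * L (\<lambda>j. j \<in> insert k T) \<le> 0"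
      using r by (intro add_nonpos_nonpos mult_nonneg_nonpos) auto
    then show ?thesis unfolding LT1 by (simp add: algebra_simps)
  qed
  then have sum_le: "(\<Sum>j\<in>UNIV. (\<theta> j - \<tau>) * (of_bool (j \<in> T) - p j)) \<le> 0"
    unfolding L_alt T0 s by (simp add: algebra_simps)
  have nonneg: "(\<theta> j - \<tau>) * (of_bool (j \<in> T) - p j) \<ge> 0" for j
    using ins[of j] out[of j] p[of j] by (cases "j \<in> T") (auto simp: zero_le_mult_iff mult_le_0_iff)
  have "\<forall>j\<in>UNIV. (\<theta> j - \<tau>) * (of_bool (j \<in> T) - p j) = 0"
    using sum_le nonneg by (subst sum_nonneg_eq_0_iff[symmetric]) (auto intro: antisym sum_nonneg)
  moreover have "of_bool (j \<in> T) - p j \<noteq> 0" for j using p[of j] by auto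
  ultimately have const: "\<theta> j = \<tau>" for j by (metis UNIV_I eq_iff_diff_eq_0 mult_eq_0_iff)
  have L_const: "L i = \<tau> * (real (num_ones i) - ?s)" for i unfolding L_alt by (simp add: const)
  have "L i = 0"
  proof (cases "r = 0")
    case True
    then show ?thesis using i S s by (simp add: L_const)
  next
    case False
    have "L (\<lambda>j. j \<in> T) \<le> 0" "L (\<lambda>j. j \<in> insert k T) \<le> 0"
      unfolding L_def by (rule le; use S False T0 T1 in simp)+
    then have "- (\<tau> * r) \<le> 0" "\<tau> * (1 - r) \<le> 0"
      unfolding L_const T0 T1 s by (simp_all add: algebra_simps)
    then have "\<tau> \<ge> 0" "\<tau> \<le> 0"
      using r False by (simp_all add: zero_le_mult_iff mult_le_0_iff)
    then have "\<tau> = 0" by simp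
    then show ?thesis by (simp add: L_const)
  qed
  then show ?thesis by (simp add: L_def)
qed

section \<open>Entropy maximization by a product-form pmf\<close>

text \<open>
  On \<open>S\<close> the logarithm of \<open>f\<close> is an affine function \<open>A\<close> of the coordinates, so \<open>f\<close> and \<open>g\<close>, which
  have the same marginals, give it the same mean. Gibbs' inequality bounds the entropy of
  \<open>g\<close> by the mean of \<open>-A\<close> under \<open>g\<close>, and the mean of \<open>-A\<close> under \<open>f\<close> is the entropy of \<open>f\<close>.
\<close>
lemma entropy_le_of_product_form:
  fixes f g :: "('n::finite \<Rightarrow> bool) pmf"
  assumes f: "\<And>i. pmf f i = (if i \<in> S then c * (\<Prod>j | i j. w j) else 0)"
    and c: "c > 0" and w: "\<And>j. w j > (0::real)"
    and g: "set_pmf g \<subseteq> S"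
    and marg: "\<And>j. (\<Sum>i\<in>UNIV. pmf g i * of_bool (i j)) = (\<Sum>i\<in>UNIV. pmf f i * of_bool (i j))"
  shows "pmf_entropy g \<le> pmf_entropy f"
proof -
  define A where "A i = ln c + (\<Sum>j\<in>UNIV. ln (w j) * of_bool (i j))" for i :: "'n \<Rightarrow> bool"
  have lnf: "ln (pmf f i) = A i" if "i \<in> S" for i
  proof -
    have "ln (pmf f i) = ln c + ln (\<Prod>j | i j. w j)"
      using that c prod_pos[of "Collect i" w] w by (simp add: f ln_mult_pos)
    also have "ln (\<Prod>j | i j. w j) = (\<Sum>j | i j. ln (w j))"
      using w by (intro ln_prod) (auto simp: less_imp_neq[symmetric])
    also have "\<dots> = (\<Sum>j\<in>UNIV. ln (w j) * of_bool (i j))"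
      by (simp add: of_bool_def if_distrib sum.If_cases cong: if_cong)
    finally show ?thesis by (simp add: A_def)
  qed
  have EA: "(\<Sum>i\<in>UNIV. pmf h i * A i) =
      ln c + (\<Sum>j\<in>UNIV. ln (w j) * (\<Sum>i\<in>UNIV. pmf h i * of_bool (i j)))" for h
  proof -
    have "(\<Sum>i\<in>UNIV. pmf h i * A i) = (\<Sum>i\<in>UNIV. pmf h i * ln c) +
        (\<Sum>i\<in>UNIV. \<Sum>j\<in>UNIV. ln (w j) * (pmf h i * of_bool (i j)))"
      unfolding A_def distrib_left sum.distrib sum_distrib_left by (simp only: mult_ac)
    also have "(\<Sum>i\<in>UNIV. \<Sum>j\<in>UNIV. ln (w j) * (pmf h i * of_bool (i j))) =
        (\<Sum>j\<in>UNIV. \<Sum>i\<in>UNIV. ln (w j) * (pmf h i * of_bool (i j)))"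
      by (rule sum.swap)
    moreover have "(\<Sum>i\<in>UNIV. pmf h i * ln c) = ln c"
      by (simp add: sum_pmf_UNIV flip: sum_distrib_right)
    ultimately show ?thesis by (simp only: sum_distrib_left)
  qed
  have gibbs: "pmf g i * A i - pmf g i * ln (pmf g i) \<le> pmf f i - pmf g i" for i
  proof (cases "i \<in> set_pmf g")
    case True
    then have gp: "pmf g i > 0" and iS: "i \<in> S" using g by (auto simp: pmf_positive)
    have fp: "pmf f i > 0" using iS c w by (simp add: f prod_pos)
    have "pmf g i * A i - pmf g i * ln (pmf g i) = pmf g i * ln (pmf f i / pmf g i)"
      using gp fp lnf[OF iS] by (simp add: ln_div algebra_simps)
    also have "\<dots> \<le> pmf g i * (pmf f i / pmf g i - 1)"
      using gp fp by (intro mult_left_mono ln_le_minus_one) auto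
    also have "\<dots> = pmf f i - pmf g i" using gp by (simp add: field_simps)
    finally show ?thesis .
  qed (simp add: set_pmf_iff)
  have "(\<Sum>i\<in>UNIV. pmf g i * A i - pmf g i * ln (pmf g i)) \<le> (\<Sum>i\<in>UNIV. pmf f i - pmf g i)"
    by (intro sum_mono gibbs)
  then have "pmf_entropy g \<le> - (\<Sum>i\<in>UNIV. pmf g i * A i)"
    by (simp add: pmf_entropy_def sum_subtractf sum_pmf_UNIV)
  also have "(\<Sum>i\<in>UNIV. pmf g i * A i) = (\<Sum>i\<in>UNIV. pmf f i * A i)"
    by (simp add: EA marg)
  also have "(\<Sum>i\<in>UNIV. pmf f i * A i) = (\<Sum>i\<in>UNIV. pmf f i * ln (pmf f i))"
  proof (rule sum.cong)
    fix i
    show "pmf f i * A i = pmf f i * ln (pmf f i)"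
      by (cases "i \<in> S") (simp_all add: lnf, simp add: f)
  qed simp
  finally show ?thesis by (simp add: pmf_entropy_def)
qed

text \<open>
  Tilting the points \<open>i - p\<close>, for \<open>i\<close> in the central slices, gives weights
  \<open>exp (t \<bullet> (i - p))\<close> whose mean is \<open>p\<close>. Up to normalization these weights are the products of
  \<open>exp (t j)\<close> over the successes \<open>j\<close>, so the logistic function of \<open>t j\<close> is the parameter wanted.
\<close>
lemma exists_conditional_bernoulli_with_marginals:
  fixes p :: "'n::finite \<Rightarrow> real"
  assumes p: "\<And>j. 0 < p j \<and> p j < 1"
  shows "\<exists>\<pi>. (\<forall>j. 0 < \<pi> j \<and> \<pi> j < 1) \<and>
    cond_pmf (indep_bernoulli \<pi>) (central_slices p) \<in> bernoulli_class p"
proof -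
  define W :: "('n \<Rightarrow> bool) \<Rightarrow> real ^ 'n" where "W i = (\<chi> j. of_bool (i j) - p j)" for i
  let ?S = "central_slices p"
  have inner: "t \<bullet> W i = (\<Sum>j\<in>UNIV. t $ j * (of_bool (i j) - p j))" for t i
    by (simp add: W_def inner_vec_def)
  obtain t where t: "(\<Sum>i\<in>?S. exp (t \<bullet> W i) *\<^sub>R W i) = 0"
  proof -
    have "\<exists>t. (\<Sum>i\<in>?S. exp (t \<bullet> W i) *\<^sub>R W i) = 0"
    proof (rule exponential_tilt_exists)
      fix t i assume "\<And>i. i \<in> ?S \<Longrightarrow> t \<bullet> W i \<le> 0" "i \<in> ?S"
      then show "t \<bullet> W i = 0"
        unfolding inner by (rule central_slices_relative_interior[of p, OF p])
    qed simp
    then show thesis using that by blast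
  qed
  define \<pi> where "\<pi> j = exp (t $ j) / (1 + exp (t $ j))" for j
  have \<pi>: "0 < \<pi> j \<and> \<pi> j < 1" for j
    by (simp add: \<pi>_def add_pos_pos)
  have w: "\<pi> j / (1 - \<pi> j) = exp (t $ j)" for j
  proof -
    have "1 + exp (t $ j) > 0" by (simp add: add_pos_pos)
    then have "1 - \<pi> j = 1 / (1 + exp (t $ j))" by (simp add: \<pi>_def field_simps)
    then show ?thesis using \<open>1 + exp (t $ j) > 0\<close> by (simp add: \<pi>_def)
  qed
  note ne = central_slices_nonempty[of p, OF p]
  let ?f = "cond_pmf (indep_bernoulli \<pi>) ?S"
  obtain c where pmf: "\<And>i. pmf ?f i = (if i \<in> ?S then c * (\<Prod>j | i j. exp (t $ j)) else 0)"
    using pmf_conditional_bernoulli[of \<pi> ?S, OF \<pi> ne] unfolding w by metis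
  define C where "C = c * exp (\<Sum>j\<in>UNIV. t $ j * p j)"
  have pmf': "pmf ?f i = (if i \<in> ?S then C * exp (t \<bullet> W i) else 0)" for i
  proof -
    have "(\<Sum>j\<in>UNIV. t $ j * p j) + t \<bullet> W i = (\<Sum>j\<in>UNIV. t $ j * of_bool (i j))"
      unfolding inner by (simp add: right_diff_distrib sum_subtractf)
    also have "\<dots> = (\<Sum>j | i j. t $ j)"
      by (simp add: of_bool_def if_distrib sum.If_cases cong: if_cong)
    finally have "exp (\<Sum>j\<in>UNIV. t $ j * p j) * exp (t \<bullet> W i) = exp (\<Sum>j | i j. t $ j)"
      by (simp only: exp_add[symmetric])
    also have "\<dots> = (\<Prod>j | i j. exp (t $ j))"
      by (rule exp_sum) simp
    finally have "exp (\<Sum>j\<in>UNIV. t $ j * p j) * exp (t \<bullet> W i) = (\<Prod>j | i j. exp (t $ j))" .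
    then show ?thesis by (simp add: pmf C_def)
  qed
  have "(\<Sum>i\<in>UNIV. pmf ?f i * of_bool (i j)) = p j" for j
  proof -
    have "(\<Sum>i\<in>UNIV. pmf ?f i * (of_bool (i j) - p j)) = (\<Sum>i\<in>?S. C * (exp (t \<bullet> W i) * W i $ j))"
      unfolding pmf' by (rule sum.mono_neutral_cong_right) (auto simp: W_def)
    also have "\<dots> = C * (\<Sum>i\<in>?S. exp (t \<bullet> W i) *\<^sub>R W i) $ j"
      by (simp add: sum_distrib_left)
    finally have "(\<Sum>i\<in>UNIV. pmf ?f i * (of_bool (i j) - p j)) = 0" by (simp add: t)
    then show ?thesis
      by (simp add: right_diff_distrib sum_subtractf sum_pmf_UNIV flip: sum_distrib_right)
  qed
  then have "?f \<in> bernoulli_class p" by (simp add: bernoulli_class_iff[OF p])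
  then show ?thesis using \<pi> by blast
qed

theorem theorem4p2:
  fixes p :: "'n::finite \<Rightarrow> real"
  assumes "\<And>j. 0 < p j \<and> p j < 1"
  shows "\<exists>f \<in> sigma_class p.
           (\<forall>g \<in> sigma_class p. pmf_entropy g \<le> pmf_entropy f) \<and>
           conditional_bernoulli f \<and>
           strongly_rayleigh f"
proof -
  obtain \<pi> where \<pi>: "\<And>j. 0 < \<pi> j \<and> \<pi> j < 1"
    and marg: "cond_pmf (indep_bernoulli \<pi>) (central_slices p) \<in> bernoulli_class p"
    using exists_conditional_bernoulli_with_marginals[of p, OF assms] by blast
  obtain m r where m: "m < CARD('n)"
    and S: "central_slices p = (if r = (0::real) then {k. num_ones k = m}
      else {k. m \<le> num_ones k \<and> num_ones k \<le> m + 1})"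
    using central_slices_cases[of p, OF assms] by blast
  note ne = central_slices_nonempty[of p, OF assms]
  define f where "f = cond_pmf (indep_bernoulli \<pi>) (central_slices p)"
  obtain c where c: "c > 0"
    and pmf: "\<And>i. pmf f i = (if i \<in> central_slices p then c * (\<Prod>j | i j. \<pi> j / (1 - \<pi> j)) else 0)"
    using pmf_conditional_bernoulli[of \<pi>, OF \<pi> ne] unfolding f_def[symmetric] by metis
  have supp: "set_pmf f \<subseteq> central_slices p" by (auto simp: set_pmf_iff pmf split: if_splits)
  have f: "f \<in> sigma_class p"
    using supp marg by (simp add: sigma_class_eq[of p, OF assms] f_def)
  have max: "pmf_entropy g \<le> pmf_entropy f" if g: "g \<in> sigma_class p" for g
  proof (rule entropy_le_of_product_form[OF pmf c])
    show "set_pmf g \<subseteq> central_slices p" using g by (simp add: sigma_class_eq[of p, OF assms])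
    show "(\<Sum>i\<in>UNIV. pmf g i * of_bool (i j)) = (\<Sum>i\<in>UNIV. pmf f i * of_bool (i j))" for j
      using f g by (simp add: sigma_class_eq[of p, OF assms] bernoulli_class_iff[of p, OF assms])
  qed (use \<pi> in simp)
  have "m \<in> {0..CARD('n)}" "m \<in> {0..CARD('n) - 1}" using m by auto
  then have cb: "conditional_bernoulli f"
  proof (cases "r = 0")
    case True
    then have "f = cond_pmf (indep_bernoulli \<pi>) {k. num_ones k = m}"
      by (simp add: f_def S)
    with \<open>m \<in> {0..CARD('n)}\<close> \<pi> show ?thesis unfolding conditional_bernoulli_def by blast
  next
    case False
    then have "f = cond_pmf (indep_bernoulli \<pi>) {k. m \<le> num_ones k \<and> num_ones k \<le> m + 1}"
      by (simp add: f_def S)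
    with \<open>m \<in> {0..CARD('n) - 1}\<close> \<pi> show ?thesis unfolding conditional_bernoulli_def by blast
  qed
  from f max cb conditional_bernoulli_imp_strongly_rayleigh[OF cb] show ?thesis by blast
qed


end
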